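(* Let $p$ be a prime, let $M=\mathbb{Z}_{p^\infty}$ be the Prüfer $p$-group, let $A=\mathbb{Z}\ltimes M$ be the trivial extension of $\mathbb{Z}$ by $M$, and let $C_p$ be the unique subgroup of $M$ of order $p$; identify a subgroup $N$ of $M$ with the ideal $0\oplus N$ of $A$. Then the coprime spectrum $\operatorname{CoSp}(A)=\{C_p,M\}$ is homeomorphic to the Sierpiński space. Indeed, its closed sets are $\varnothing$, $V_c(C_p)=\{C_p\}$ and $V_c(M)=\operatorname{CoSp}(A)$, so its open sets are $\varnothing$, $\{M\}$ and $\operatorname{CoSp}(A)$. Thus $M$ is the generic point and $C_p$ is the unique closed point.
   Context: All rings are commutative with identity. For ideals $I,J$ of a ring $A$, $\operatorname{Ann}(I)=\{a\in A\mid aI=0\}$ and $(J:I)=\{a\in A\mid aI\subseteq J\}$. The coproduct of $I$ and $J$ is the ideal $[I:J]:=(J:\operatorname{Ann}(I))=\{a\in A\mid a\operatorname{Ann}(I)\subseteq J\}$. An ideal $C$ of $A$ is coprime if $C\neq 0$ and, for all ideals $I,J$ of $A$, $C\subseteq [I:J]$ implies $C\subseteq I$ or $C\subseteq J$. $\operatorname{CoSp}(A)$ is the set of coprime ideals of $A$, regarded as a topological space whose closed sets are exactly the sets $V_c(I)=\{C\in\operatorname{CoSp}(A)\mid C\subseteq I\}$ for $I$ an ideal of $A$. The trivial extension $R\ltimes M$ of a commutative ring $R$ by an $R$-module $M$ is the commutative ring with underlying additive group $R\oplus M$, multiplication $(r,m)(s,n)=(rs,rn+sm)$, and identity $(1,0)$.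 The Prüfer $p$-group $\mathbb{Z}_{p^\infty}$ is the subgroup of $\mathbb{Q}/\mathbb{Z}$ consisting of all elements whose order is a power of $p$. The Sierpiński space is the two-point space with exactly three open sets: the empty set, one singleton, and the whole space. *)

theory Defs
  imports
    "HOL-Analysis.Abstract_Topology"
    "HOL-Computational_Algebra.Primes"
    "HOL-Algebra.Module"
    "HOL-Algebra.IntRing"
    "HOL-Algebra.Multiplicative_Group"
begin

subsection \<open>Coprime ideals and the coprime spectrum\<close>

definition annihilator :: "('a, 'm) ring_scheme \<Rightarrow> 'a set \<Rightarrow> 'a set" where
  "annihilator A I = {a \<in> carrier A. \<forall>x\<in>I. a \<otimes>\<^bsub>A\<^esub> x = \<zero>\<^bsub>A\<^esub>}"

definition ideal_quotient :: "('a, 'm) ring_scheme \<Rightarrow> 'a set \<Rightarrow> 'a set \<Rightarrow> 'a set" where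
  "ideal_quotient A J I = {a \<in> carrier A. \<forall>x\<in>I. a \<otimes>\<^bsub>A\<^esub> x \<in> J}"

text \<open>The coproduct \<open>[I:J] = (J : Ann(I))\<close>; note the exchanged order of the arguments.\<close>

definition ideal_coproduct :: "('a, 'm) ring_scheme \<Rightarrow> 'a set \<Rightarrow> 'a set \<Rightarrow> 'a set" where
  "ideal_coproduct A I J = ideal_quotient A J (annihilator A I)"

definition coprime_ideal :: "('a, 'm) ring_scheme \<Rightarrow> 'a set \<Rightarrow> bool" where
  "coprime_ideal A C \<longleftrightarrow> ideal C A \<and> C \<noteq> {\<zero>\<^bsub>A\<^esub>} \<and>
     (\<forall>I J. ideal I A \<and> ideal J A \<and> C \<subseteq> ideal_coproduct A I J \<longrightarrow> C \<subseteq> I \<or> C \<subseteq> J)"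

definition CoSp :: "('a, 'm) ring_scheme \<Rightarrow> 'a set set" where
  "CoSp A = {C. coprime_ideal A C}"

definition V\<^sub>c :: "('a, 'm) ring_scheme \<Rightarrow> 'a set \<Rightarrow> 'a set set" where
  "V\<^sub>c A I = {C \<in> CoSp A. C \<subseteq> I}"

text \<open>The lemma \<open>closedin_CoSp_topology\<close> below shows that, for every commutative ring,
  the closed sets of this topology are exactly the sets \<open>V\<^sub>c A I\<close>.\<close>

definition CoSp_topology :: "('a, 'm) ring_scheme \<Rightarrow> 'a set topology" where
  "CoSp_topology A =
     topology (\<lambda>U. U \<subseteq> CoSp A \<and> (\<exists>I. ideal I A \<and> CoSp A - U = V\<^sub>c A I))"

context cring
begin

lemma ideal_ideal_coproduct:
  assumes I: "ideal I R" and J: "ideal J R"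
  shows "ideal (ideal_coproduct R I J) R"
proof -
  interpret J: ideal J R by (rule J)
  have ann: "x \<in> carrier R" if "x \<in> annihilator R I" for x
    using that by (simp add: annihilator_def)
  show ?thesis
  proof (rule idealI)
    show "subgroup (ideal_coproduct R I J) (add_monoid R)"
    proof (rule add.subgroupI)
      show "ideal_coproduct R I J \<subseteq> carrier R"
        by (auto simp: ideal_coproduct_def ideal_quotient_def)
      have "\<zero> \<in> ideal_coproduct R I J"
        using ann by (auto simp: ideal_coproduct_def ideal_quotient_def)
      then show "ideal_coproduct R I J \<noteq> {}" by blast
    next
      fix a assume "a \<in> ideal_coproduct R I J"
      then show "\<ominus> a \<in> ideal_coproduct R I J"
        using ann by (auto simp: ideal_coproduct_def ideal_quotient_def l_minus)
    next
      fix a b assume "a \<in> ideal_coproduct R I J" "b \<in> ideal_coproduct R I J"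
      then show "a \<oplus> b \<in> ideal_coproduct R I J"
        using ann by (auto simp: ideal_coproduct_def ideal_quotient_def l_distr)
    qed
  next
    fix a x assume "a \<in> ideal_coproduct R I J" "x \<in> carrier R"
    then show "x \<otimes> a \<in> ideal_coproduct R I J"
      using ann by (auto simp: ideal_coproduct_def ideal_quotient_def m_assoc J.I_l_closed)
  next
    fix a x assume "a \<in> ideal_coproduct R I J" "x \<in> carrier R"
    then show "a \<otimes> x \<in> ideal_coproduct R I J"
      using ann
      by (auto simp: ideal_coproduct_def ideal_quotient_def m_comm[of a x] m_assoc J.I_l_closed)
  qed (rule ring_axioms)
qed

lemma le_ideal_coproduct:
  assumes I: "ideal I R" and J: "ideal J R"
  shows "I \<subseteq> ideal_coproduct R I J" "J \<subseteq> ideal_coproduct R I J"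
proof -
  interpret I: ideal I R by (rule I)
  interpret J: ideal J R by (rule J)
  show "I \<subseteq> ideal_coproduct R I J"
  proof
    fix a assume a: "a \<in> I"
    have "a \<otimes> x \<in> J" if "x \<in> annihilator R I" for x
    proof -
      have x: "x \<in> carrier R" "x \<otimes> a = \<zero>"
        using that a by (auto simp: annihilator_def)
      then have "a \<otimes> x = \<zero>" using I.Icarr[OF a] by (simp add: m_comm)
      then show ?thesis by simp
    qed
    then show "a \<in> ideal_coproduct R I J"
      using I.Icarr[OF a] by (auto simp: ideal_coproduct_def ideal_quotient_def)
  qed
  show "J \<subseteq> ideal_coproduct R I J"
    using J.Icarr J.I_r_closed
    by (auto simp: ideal_coproduct_def ideal_quotient_def annihilator_def)
qed

lemma Vc_Un:
  assumes I: "ideal I R" and J: "ideal J R"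
  shows "V\<^sub>c R I \<union> V\<^sub>c R J = V\<^sub>c R (ideal_coproduct R I J)"
  using le_ideal_coproduct[OF I J] I J
  unfolding V\<^sub>c_def CoSp_def coprime_ideal_def by blast

lemma Vc_zero: "V\<^sub>c R {\<zero>} = {}"
proof -
  have "C = {\<zero>}" if "ideal C R" "C \<subseteq> {\<zero>}" for C
    using that additive_subgroup.zero_closed[of C R] by (auto simp: ideal_def)
  then show ?thesis unfolding V\<^sub>c_def CoSp_def coprime_ideal_def by blast
qed

lemma Vc_carrier: "V\<^sub>c R (carrier R) = CoSp R"
  by (auto simp: V\<^sub>c_def CoSp_def coprime_ideal_def
      dest: ideal.axioms(1) additive_subgroup.a_Hcarr)

lemma Vc_Inter: "S \<noteq> {} \<Longrightarrow> V\<^sub>c R (\<Inter>S) = (\<Inter>I\<in>S. V\<^sub>c R I)"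
  by (auto simp: V\<^sub>c_def)

lemma istopology_CoSp:
  "istopology (\<lambda>U. U \<subseteq> CoSp R \<and> (\<exists>I. ideal I R \<and> CoSp R - U = V\<^sub>c R I))"
  unfolding istopology_def
proof (intro conjI allI impI)
  fix S T
  assume S: "S \<subseteq> CoSp R \<and> (\<exists>I. ideal I R \<and> CoSp R - S = V\<^sub>c R I)"
    and T: "T \<subseteq> CoSp R \<and> (\<exists>I. ideal I R \<and> CoSp R - T = V\<^sub>c R I)"
  from S show "S \<inter> T \<subseteq> CoSp R" by blast
  from S T obtain I J where IJ: "ideal I R" "CoSp R - S = V\<^sub>c R I"
    "ideal J R" "CoSp R - T = V\<^sub>c R J" by blast
  then have "CoSp R - S \<inter> T = V\<^sub>c R (ideal_coproduct R I J)"
    by (metis Diff_Int Vc_Un)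
  then show "\<exists>I. ideal I R \<and> CoSp R - S \<inter> T = V\<^sub>c R I"
    using ideal_ideal_coproduct IJ by blast
next
  fix K
  assume K: "\<forall>U\<in>K. U \<subseteq> CoSp R \<and> (\<exists>I. ideal I R \<and> CoSp R - U = V\<^sub>c R I)"
  then show "\<Union>K \<subseteq> CoSp R" by blast
  show "\<exists>I. ideal I R \<and> CoSp R - \<Union>K = V\<^sub>c R I"
  proof (cases "K = {}")
    case True
    then show ?thesis using Vc_carrier oneideal by auto
  next
    case False
    from K obtain f where f: "\<And>U. U \<in> K \<Longrightarrow> ideal (f U) R"
      "\<And>U. U \<in> K \<Longrightarrow> CoSp R - U = V\<^sub>c R (f U)" by metis
    have "V\<^sub>c R (\<Inter>(f ` K)) = (\<Inter>U\<in>K. CoSp R - U)"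
      using False f by (subst Vc_Inter) auto
    also have "\<dots> = CoSp R - \<Union>K" using False by auto
    finally have "CoSp R - \<Union>K = V\<^sub>c R (\<Inter>(f ` K))" ..
    moreover have "ideal (\<Inter>(f ` K)) R"
      using False f by (intro i_Intersect) auto
    ultimately show ?thesis by blast
  qed
qed

lemma openin_CoSp_topology:
  "openin (CoSp_topology R) U \<longleftrightarrow> U \<subseteq> CoSp R \<and> (\<exists>I. ideal I R \<and> CoSp R - U = V\<^sub>c R I)"
  unfolding CoSp_topology_def by (subst topology_inverse'[OF istopology_CoSp]) simp

lemma topspace_CoSp_topology: "topspace (CoSp_topology R) = CoSp R"
proof -
  have "openin (CoSp_topology R) (CoSp R)"
    unfolding openin_CoSp_topology using Vc_zero zeroideal by auto
  then show ?thesis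
    unfolding topspace_def using openin_CoSp_topology by blast
qed

lemma closedin_CoSp_topology:
  "closedin (CoSp_topology R) F \<longleftrightarrow> (\<exists>I. ideal I R \<and> F = V\<^sub>c R I)"
proof -
  have "V\<^sub>c R I \<subseteq> CoSp R" for I by (auto simp: V\<^sub>c_def)
  then show ?thesis
    unfolding closedin_def topspace_CoSp_topology openin_CoSp_topology
    by (metis Diff_subset double_diff order_refl)
qed

end


subsection \<open>Trivial extensions\<close>

definition trivial_extension ::
  "('a, 'm) ring_scheme \<Rightarrow> ('a, 'b, 'n) module_scheme \<Rightarrow> ('a \<times> 'b) ring" where
  "trivial_extension R M =
     \<lparr>carrier = carrier R \<times> carrier M,
      monoid.mult = (\<lambda>(r, m) (s, n). (r \<otimes>\<^bsub>R\<^esub> s, r \<odot>\<^bsub>M\<^esub> n \<oplus>\<^bsub>M\<^esub> s \<odot>\<^bsub>M\<^esub> m)),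
      one = (\<one>\<^bsub>R\<^esub>, \<zero>\<^bsub>M\<^esub>),
      zero = (\<zero>\<^bsub>R\<^esub>, \<zero>\<^bsub>M\<^esub>),
      add = (\<lambda>(r, m) (s, n). (r \<oplus>\<^bsub>R\<^esub> s, m \<oplus>\<^bsub>M\<^esub> n))\<rparr>"

lemma (in module) cring_trivial_extension: "cring (trivial_extension R M)"
proof (rule cringI)
  show "abelian_group (trivial_extension R M)"
  proof (rule abelian_groupI)
    fix x assume "x \<in> carrier (trivial_extension R M)"
    then show "\<exists>y\<in>carrier (trivial_extension R M).
        y \<oplus>\<^bsub>trivial_extension R M\<^esub> x = \<zero>\<^bsub>trivial_extension R M\<^esub>"
      by (intro bexI[of _ "(\<ominus> fst x, \<ominus>\<^bsub>M\<^esub> snd x)"])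
        (auto simp: trivial_extension_def R.l_neg M.l_neg)
  qed (auto simp: trivial_extension_def R.a_ac M.a_ac)
  show "comm_monoid (trivial_extension R M)"
    by (rule comm_monoidI)
      (auto simp: trivial_extension_def R.m_ac M.a_ac smult_r_distr smult_assoc1[symmetric])
qed (auto simp: trivial_extension_def R.l_distr smult_l_distr smult_r_distr M.a_ac)

text \<open>The set \<open>0 \<oplus> N\<close>; it is an ideal of the trivial extension when \<open>N\<close> is a submodule,
  hence over the integers for every subgroup \<open>N\<close>.\<close>

definition zero_plus :: "('a, 'm) ring_scheme \<Rightarrow> 'b set \<Rightarrow> ('a \<times> 'b) set" where
  "zero_plus R N = {\<zero>\<^bsub>R\<^esub>} \<times> N"

lemma (in module) ideal_zero_plus:
  assumes N: "subgroup N (add_monoid M)"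
    and smult: "\<And>r n. r \<in> carrier R \<Longrightarrow> n \<in> N \<Longrightarrow> r \<odot>\<^bsub>M\<^esub> n \<in> N"
  shows "ideal (zero_plus R N) (trivial_extension R M)"
proof -
  let ?A = "trivial_extension R M"
  interpret A: cring ?A by (rule cring_trivial_extension)
  interpret N: subgroup N "add_monoid M" by (rule N)
  have N_carrier: "n \<in> carrier M" if "n \<in> N" for n
    using N.subset that by auto
  have neg: "\<ominus>\<^bsub>?A\<^esub> (\<zero>, n) = (\<zero>, \<ominus>\<^bsub>M\<^esub> n)" if "n \<in> N" for n
    using N_carrier[OF that]
    by (intro A.minus_equality) (auto simp: trivial_extension_def M.l_neg)
  have N_neg: "\<ominus>\<^bsub>M\<^esub> n \<in> N" if "n \<in> N" for n
    using N.m_inv_closed[OF that] by (simp add: a_inv_def)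
  have N_add: "m \<oplus>\<^bsub>M\<^esub> n \<in> N" if "m \<in> N" "n \<in> N" for m n
    using N.m_closed[OF that] by simp
  have N_zero: "\<zero>\<^bsub>M\<^esub> \<in> N"
    using N.one_closed by simp
  show ?thesis
  proof (rule idealI)
    show "subgroup (zero_plus R N) (add_monoid ?A)"
    proof (rule A.add.subgroupI)
      show "zero_plus R N \<subseteq> carrier ?A"
        using N_carrier by (auto simp: zero_plus_def trivial_extension_def)
      show "zero_plus R N \<noteq> {}"
        using N_zero by (auto simp: zero_plus_def)
    next
      fix a assume "a \<in> zero_plus R N"
      then obtain n where "a = (\<zero>, n)" "n \<in> N" by (auto simp: zero_plus_def)
      then show "\<ominus>\<^bsub>?A\<^esub> a \<in> zero_plus R N"
        unfolding zero_plus_def by (simp only: neg) (simp add: N_neg)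
    next
      fix a b assume "a \<in> zero_plus R N" "b \<in> zero_plus R N"
      then obtain m n where mn: "a = (\<zero>, m)" "m \<in> N" "b = (\<zero>, n)" "n \<in> N"
        by (auto simp: zero_plus_def)
      then have "a \<oplus>\<^bsub>?A\<^esub> b = (\<zero>, m \<oplus>\<^bsub>M\<^esub> n)"
        by (simp add: trivial_extension_def)
      then show "a \<oplus>\<^bsub>?A\<^esub> b \<in> zero_plus R N"
        using N_add[OF mn(2,4)] by (simp add: zero_plus_def)
    qed
  next
    fix a x assume a: "a \<in> zero_plus R N" and x: "x \<in> carrier ?A"
    from a obtain n where n: "a = (\<zero>, n)" "n \<in> N" by (auto simp: zero_plus_def)
    from x obtain r m where r: "x = (r, m)" "r \<in> carrier R" "m \<in> carrier M"
      by (auto simp: trivial_extension_def)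
    have "x \<otimes>\<^bsub>?A\<^esub> a = (\<zero>, r \<odot>\<^bsub>M\<^esub> n)"
      using n r N_carrier[OF n(2)] by (simp add: trivial_extension_def)
    then show *: "x \<otimes>\<^bsub>?A\<^esub> a \<in> zero_plus R N"
      using smult[OF r(2) n(2)] by (simp add: zero_plus_def)
    have "a \<in> carrier ?A"
      using n N_carrier[OF n(2)] by (simp add: trivial_extension_def)
    with x * show "a \<otimes>\<^bsub>?A\<^esub> x \<in> zero_plus R N"
      by (simp add: A.m_comm)
  qed (rule A.ring_axioms)
qed



subsection \<open>The Pruefer group\<close>

definition rat_group :: "rat monoid" where
  "rat_group = \<lparr>carrier = UNIV, monoid.mult = (+), one = 0\<rparr>"

definition rat_mod_int :: "rat set monoid" where
  "rat_mod_int = rat_group Mod \<int>"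

text \<open>An element of infinite order has \<open>group.ord\<close> equal to \<open>0\<close>, so it is excluded below.
  The multiplicative components of the record play no role for a module.\<close>

definition pruefer_module :: "nat \<Rightarrow> (int, rat set) module" where
  "pruefer_module p =
     \<lparr>carrier = {x \<in> carrier rat_mod_int. \<exists>k. group.ord rat_mod_int x = p ^ k},
      monoid.mult = (\<lambda>_ _. undefined),
      one = undefined,
      zero = \<one>\<^bsub>rat_mod_int\<^esub>,
      add = (\<otimes>\<^bsub>rat_mod_int\<^esub>),
      smult = (\<lambda>k x. x [^]\<^bsub>rat_mod_int\<^esub> k)\<rparr>"

lemma comm_group_rat_group: "comm_group rat_group"
  by (rule comm_groupI)
    (auto simp: rat_group_def intro: exI[of _ "- x" for x])

lemma subgroup_Ints_rat_group: "subgroup \<int> rat_group"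
proof -
  interpret G: comm_group rat_group by (rule comm_group_rat_group)
  have inv: "inv\<^bsub>rat_group\<^esub> x = - x" for x
    by (rule G.inv_equality) (auto simp: rat_group_def)
  show ?thesis
    by (rule G.subgroupI) (auto simp: inv, auto simp: rat_group_def)
qed

lemma comm_group_rat_mod_int: "comm_group rat_mod_int"
  unfolding rat_mod_int_def
  by (rule comm_group.abelian_FactGroup[OF comm_group_rat_group subgroup_Ints_rat_group])

lemma carrier_pruefer_module:
  assumes "prime p"
  shows "x \<in> carrier (pruefer_module p) \<longleftrightarrow>
    x \<in> carrier rat_mod_int \<and> (\<exists>k. x [^]\<^bsub>rat_mod_int\<^esub> (p ^ k) = \<one>\<^bsub>rat_mod_int\<^esub>)"
proof -
  interpret G: comm_group rat_mod_int by (rule comm_group_rat_mod_int)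
  have "(\<exists>k. G.ord x = p ^ k) \<longleftrightarrow> (\<exists>k. G.ord x dvd p ^ k)"
    using assms by (metis divides_primepow_nat dvd_refl)
  then show ?thesis by (auto simp: pruefer_module_def G.pow_eq_id)
qed

lemma module_pruefer_module:
  assumes p: "prime p"
  shows "module int_ring (pruefer_module p)"
proof -
  interpret G: comm_group rat_mod_int by (rule comm_group_rat_mod_int)
  let ?M = "pruefer_module p"
  have sub: "x \<in> carrier rat_mod_int" if "x \<in> carrier ?M" for x
    using that by (simp add: pruefer_module_def)
  have add: "x \<oplus>\<^bsub>?M\<^esub> y = x \<otimes>\<^bsub>rat_mod_int\<^esub> y" for x y
    by (simp add: pruefer_module_def)
  have zero: "\<zero>\<^bsub>?M\<^esub> = \<one>\<^bsub>rat_mod_int\<^esub>" by (simp add: pruefer_module_def)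
  have smult: "k \<odot>\<^bsub>?M\<^esub> x = x [^]\<^bsub>rat_mod_int\<^esub> k" for k x
    by (simp add: pruefer_module_def)
  have smult_cl: "x [^]\<^bsub>rat_mod_int\<^esub> (k::int) \<in> carrier ?M" if x: "x \<in> carrier ?M" for k x
  proof -
    from x p obtain n where n: "x [^]\<^bsub>rat_mod_int\<^esub> (p ^ n) = \<one>\<^bsub>rat_mod_int\<^esub>"
      by (auto simp: carrier_pruefer_module)
    have "(x [^]\<^bsub>rat_mod_int\<^esub> k) [^]\<^bsub>rat_mod_int\<^esub> (int (p ^ n)) =
        (x [^]\<^bsub>rat_mod_int\<^esub> (int (p ^ n))) [^]\<^bsub>rat_mod_int\<^esub> k"
      using sub[OF x] by (simp only: G.int_pow_pow mult.commute)
    then show ?thesis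
      using p n sub[OF x] by (auto simp: carrier_pruefer_module int_pow_int simp del: of_nat_power)
  qed
  have add_cl: "x \<otimes>\<^bsub>rat_mod_int\<^esub> y \<in> carrier ?M"
    if x: "x \<in> carrier ?M" and y: "y \<in> carrier ?M" for x y
  proof -
    from x y p obtain m n where
      m: "x [^]\<^bsub>rat_mod_int\<^esub> (p ^ m) = \<one>\<^bsub>rat_mod_int\<^esub>" and
      n: "y [^]\<^bsub>rat_mod_int\<^esub> (p ^ n) = \<one>\<^bsub>rat_mod_int\<^esub>"
      by (auto simp: carrier_pruefer_module)
    then have "x [^]\<^bsub>rat_mod_int\<^esub> (p ^ (m + n)) = \<one>\<^bsub>rat_mod_int\<^esub>"
      "y [^]\<^bsub>rat_mod_int\<^esub> (p ^ (m + n)) = \<one>\<^bsub>rat_mod_int\<^esub>"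
      using sub[OF x] sub[OF y] by (auto simp: G.pow_eq_id power_add)
    then show ?thesis
      using p sub[OF x] sub[OF y]
      by (auto simp: carrier_pruefer_module G.nat_pow_distrib intro!: exI[of _ "m + n"])
  qed
  show ?thesis
  proof (rule moduleI)
    show "cring int_ring" by (rule int_is_cring)
    show "abelian_group ?M"
    proof (rule abelian_groupI)
      fix x assume x: "x \<in> carrier ?M"
      have "inv\<^bsub>rat_mod_int\<^esub> x \<in> carrier ?M"
        using smult_cl[OF x, of "- 1"] sub[OF x] by (simp add: G.int_pow_neg)
      then show "\<exists>y\<in>carrier ?M. y \<oplus>\<^bsub>?M\<^esub> x = \<zero>\<^bsub>?M\<^esub>"
        using sub[OF x] by (intro bexI[of _ "inv\<^bsub>rat_mod_int\<^esub> x"]) (auto simp: add zero)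
    qed (use sub p add_cl in \<open>auto simp: add zero G.m_ac carrier_pruefer_module\<close>)
  qed (use sub smult_cl in \<open>auto simp: add smult G.int_pow_mult G.int_pow_distrib
        G.int_pow_pow mult.commute\<close>)
qed

definition pruefer_order_p_subgroup :: "nat \<Rightarrow> rat set set" where
  "pruefer_order_p_subgroup p =
     (THE N. subgroup N (add_monoid (pruefer_module p)) \<and> card N = p)"


subsection \<open>The Sierpinski space\<close>

definition sierpinski_space :: "bool topology" where
  "sierpinski_space = topology (\<lambda>U. U \<in> {{}, {True}, UNIV})"

lemma openin_sierpinski_space: "openin sierpinski_space U \<longleftrightarrow> U \<in> {{}, {True}, UNIV}"
proof -
  have "istopology (\<lambda>U::bool set. U \<in> {{}, {True}, UNIV})"
    unfolding istopology_def
  proof (intro conjI allI impI)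
    fix K :: "bool set set"
    assume K: "\<forall>U\<in>K. U \<in> {{}, {True}, UNIV}"
    show "\<Union>K \<in> {{}, {True}, UNIV}"
    proof (cases "UNIV \<in> K")
      case True
      then have "\<Union>K = UNIV" by blast
      then show ?thesis by simp
    next
      case False
      with K have "K \<subseteq> {{}, {True}}" by blast
      then have "\<Union>K \<subseteq> {True}" by blast
      then have "\<Union>K = {} \<or> \<Union>K = {True}" by (simp only: subset_singleton_iff)
      then show ?thesis by blast
    qed
  qed auto
  then show ?thesis by (simp add: sierpinski_space_def topology_inverse')
qed

end

theory Submission
  imports Defs
begin

text \<open>
  Besides divisibility and \<open>p\<close>-torsion, the only property of the Pruefer group that matters is that
  of any two elements one is a multiple of the other. By divisibility, an ideal of
  \<open>\<int> \<ltimes> M\<close> with an element outside \<open>0 \<oplus> M\<close> contains \<open>0 \<oplus> M\<close>; by comparability, an ideal that does not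
  contain \<open>(0, x)\<close> lies in \<open>0 \<oplus> N\<close> with \<open>N\<close> killed by every \<open>p\<^sup>n\<close> that kills \<open>x\<close>. So a coproduct
  \<open>[I:J]\<close> with \<open>M \<not>\<subseteq> I\<close> and \<open>M \<subseteq> [I:J]\<close> has \<open>p\<^sup>n \<in> Ann(I)\<close>, whence \<open>M = p\<^sup>nM \<subseteq> J\<close>; and \<open>M[p]\<close> lies in
  every nonzero ideal. Conversely, a coprime ideal lies in \<open>M\<close> because it lies in \<open>[M:M]\<close>, and if
  it is proper in \<open>M\<close> and \<open>n\<close> is least such that \<open>p\<^sup>n\<close> kills it, then it lies in \<open>[M[p]:M[p\<^bsup>n-1\<^esup>]]\<close>, hence
  in \<open>M[p]\<close>, and so equals \<open>M[p]\<close>.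
\<close>

subsection \<open>Coprime spectra that are two-element chains\<close>

context cring
begin

context
  fixes C D
  assumes CoSp: "CoSp R = {C, D}" and less: "C \<subset> D"
begin

lemma Vc_chain: "V\<^sub>c R C = {C}" "V\<^sub>c R D = CoSp R"
  using CoSp less by (auto simp: V\<^sub>c_def)

text \<open>\<open>V\<^sub>c R I\<close> is closed downwards under inclusion, so it cannot contain
  \<open>D\<close> without \<open>C\<close>. The zero ideal supplies the empty set.\<close>

lemma closedin_chain: "{F. closedin (CoSp_topology R) F} = {{}, {C}, {C, D}}"
proof -
  have ideals: "ideal C R" "ideal D R"
    using CoSp by (auto simp: CoSp_def coprime_ideal_def)
  have "V\<^sub>c R I \<in> {{}, {C}, {C, D}}" for I
    using CoSp less unfolding V\<^sub>c_def by auto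
  moreover have "\<exists>I. ideal I R \<and> F = V\<^sub>c R I" if "F \<in> {{}, {C}, {C, D}}" for F
    using that ideals zeroideal Vc_zero Vc_chain CoSp by blast
  ultimately show ?thesis
    unfolding closedin_CoSp_topology by blast
qed

lemma openin_chain: "{U. openin (CoSp_topology R) U} = {{}, {D}, {C, D}}"
proof -
  have closed: "closedin (CoSp_topology R) F \<longleftrightarrow> F \<in> {{}, {C}, {C, D}}" for F
    using closedin_chain by blast
  have op: "openin (CoSp_topology R) U \<longleftrightarrow> U \<subseteq> {C, D} \<and> {C, D} - U \<in> {{}, {C}, {C, D}}" for U
    unfolding openin_closedin_eq topspace_CoSp_topology CoSp closed ..
  have compl: "{C, D} - {C} = {D}" "{C, D} - {D} = {C}"
    using less by auto
  have "U \<in> {{}, {D}, {C, D}}" if "openin (CoSp_topology R) U" for U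
  proof -
    have "U \<in> {{}, {C}, {D}, {C, D}}"
      using that[unfolded op] by auto
    \<comment> \<open>If \<open>{C}\<close> were open, its complement \<open>{D}\<close> would be
      closed, although it is not downward closed.\<close>
    moreover have "U \<noteq> {C}"
    proof
      assume "U = {C}"
      then have "{D} \<in> {{}, {C}, {C, D}}" using that[unfolded op] compl(1) by metis
      then show False using less by auto
    qed
    ultimately show ?thesis by blast
  qed
  moreover have "openin (CoSp_topology R) {D}" unfolding op compl by simp
  moreover have "openin (CoSp_topology R) {}" "openin (CoSp_topology R) {C, D}"
    unfolding op by simp_all
  ultimately show ?thesis by blast
qed

text \<open>Among the three closed sets only the whole space contains \<open>D\<close>; this makes
  \<open>D\<close> generic.\<close>

lemma closure_of_chain: "CoSp_topology R closure_of {C} = {C}"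
  "CoSp_topology R closure_of {D} = {C, D}"
proof -
  have "closedin (CoSp_topology R) {C}"
    using closedin_chain by blast
  then show "CoSp_topology R closure_of {C} = {C}"
    by (simp add: closure_of_closedin)
  have "CoSp_topology R closure_of {D} \<in> {{}, {C}, {C, D}}"
    using closedin_closure_of closedin_chain by blast
  moreover have "D \<in> CoSp_topology R closure_of {D}"
    using closure_of_subset[of "{D}" "CoSp_topology R"] CoSp by (auto simp: topspace_CoSp_topology)
  ultimately show "CoSp_topology R closure_of {D} = {C, D}"
    using less by blast
qed

text \<open>The open singletons correspond: \<open>D\<close> goes to \<open>True\<close>,
  \<open>C\<close> to \<open>False\<close>.\<close>

lemma homeomorphic_sierpinski_chain: "CoSp_topology R homeomorphic_space sierpinski_space"
proof -
  let ?f = "\<lambda>P. P = D" and ?g = "\<lambda>b. if b then D else C"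
  have top: "topspace sierpinski_space = UNIV"
    using openin_sierpinski_space openin_subset by blast
  have op: "openin (CoSp_topology R) U \<longleftrightarrow> U \<in> {{}, {D}, {C, D}}" for U
    using openin_chain by blast
  have "continuous_map (CoSp_topology R) sierpinski_space ?f"
    unfolding continuous_map_def top topspace_CoSp_topology CoSp op openin_sierpinski_space
    using less by auto
  moreover have "continuous_map sierpinski_space (CoSp_topology R) ?g"
    unfolding continuous_map_def top topspace_CoSp_topology CoSp op openin_sierpinski_space
  proof (intro conjI allI impI)
    fix U assume U: "U \<in> {{}, {D}, {C, D}}"
    have pre: "{b \<in> UNIV. ?g b \<in> {}} = {}" "{b \<in> UNIV. ?g b \<in> {D}} = {True}"
      "{b \<in> UNIV. ?g b \<in> {C, D}} = UNIV"
      using less by auto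
    from U show "{b \<in> UNIV. ?g b \<in> U} \<in> {{}, {True}, UNIV}"
      by (elim insertE emptyE) (simp_all only: pre, simp_all)
  qed simp
  ultimately have "homeomorphic_maps (CoSp_topology R) sierpinski_space ?f ?g"
    using less by (auto simp: homeomorphic_maps_def topspace_CoSp_topology CoSp)
  then show ?thesis
    unfolding homeomorphic_space_def by blast
qed

end

end


subsection \<open>Divisible uniserial torsion groups\<close>

text \<open>Bezout for \<open>b\<close> and \<open>p ^ n\<close>: it provides the inverse
  \<open>u\<close> of \<open>b\<close> on anything killed by \<open>p ^ n\<close>.\<close>

lemma coprime_prime_power:
  assumes "prime (p::nat)" "\<not> int p dvd b"
  shows "\<exists>u v. u * b + v * int p ^ n = 1"
proof -
  have "coprime b (int p ^ n)"
    using assms by (metis coprime_commute coprime_power_right_iff prime_imp_coprime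
        prime_nat_int_transfer)
  then show ?thesis using bezout_int[of b "int p ^ n"] by auto
qed


text \<open>The assumptions characterise the Pruefer \<open>p\<close>-group up to isomorphism. The
  ideal theory below is carried out from them alone, away from cosets of rationals.\<close>

locale divisible_uniserial_p_group = module int_ring M
  for M :: "(int, 'b, 'c) module_scheme" (structure) and p :: nat +
  assumes prime: "prime p"
    and divisible: "\<And>k x. k \<noteq> 0 \<Longrightarrow> x \<in> carrier M \<Longrightarrow> \<exists>y\<in>carrier M. x = k \<odot>\<^bsub>M\<^esub> y"
    and p_torsion: "\<And>x. x \<in> carrier M \<Longrightarrow> \<exists>n. int p ^ n \<odot>\<^bsub>M\<^esub> x = \<zero>\<^bsub>M\<^esub>"
    and comparable: "\<And>x y. x \<in> carrier M \<Longrightarrow> y \<in> carrier M \<Longrightarrow>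
      \<exists>k. x = k \<odot>\<^bsub>M\<^esub> y \<or> y = k \<odot>\<^bsub>M\<^esub> x"
    and nontrivial: "carrier M \<noteq> {\<zero>\<^bsub>M\<^esub>}"
begin

section \<open>Integer multiples and torsion subgroups\<close>

lemma zsmult:
  assumes "x \<in> carrier M"
  shows "k \<odot>\<^bsub>M\<^esub> x \<in> carrier M" "(k + l) \<odot>\<^bsub>M\<^esub> x = k \<odot>\<^bsub>M\<^esub> x \<oplus>\<^bsub>M\<^esub> l \<odot>\<^bsub>M\<^esub> x"
    "k \<odot>\<^bsub>M\<^esub> (l \<odot>\<^bsub>M\<^esub> x) = (k * l) \<odot>\<^bsub>M\<^esub> x" "0 \<odot>\<^bsub>M\<^esub> x = \<zero>\<^bsub>M\<^esub>" "1 \<odot>\<^bsub>M\<^esub> x = x"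
  using assms smult_closed[of k x] smult_l_distr[of k l x] smult_assoc1[of k l x]
    smult_l_null[of x] smult_one[of x] by simp_all

lemma zsmult_zero: "k \<odot>\<^bsub>M\<^esub> \<zero>\<^bsub>M\<^esub> = \<zero>\<^bsub>M\<^esub>"
  using smult_r_null[of k] by simp

definition tor :: "int \<Rightarrow> 'b set" where
  "tor k = {x \<in> carrier M. k \<odot>\<^bsub>M\<^esub> x = \<zero>\<^bsub>M\<^esub>}"

text \<open>Over the integers subgroups are submodules, as \<open>ideal_zero_plus\<close> demands.
  The induction runs upwards and downwards from \<open>0\<close>.\<close>

lemma subgroup_zsmult_closed:
  assumes "subgroup N (add_monoid M)" "x \<in> N"
  shows "k \<odot>\<^bsub>M\<^esub> x \<in> N"
proof -
  interpret N: subgroup N "add_monoid M" by fact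
  have x: "x \<in> carrier M" using N.subset assms by auto
  have mx: "\<ominus>\<^bsub>M\<^esub> x \<in> N" using N.m_inv_closed[OF assms(2)] by (simp add: a_inv_def)
  have m1: "(- 1) \<odot>\<^bsub>M\<^esub> x = \<ominus>\<^bsub>M\<^esub> x"
    using zsmult(2)[OF x, of "- 1" 1] x
    by (intro M.minus_equality[symmetric]) (simp_all add: zsmult)
  show ?thesis
  proof (induction k rule: int_induct[where k = 0])
    case base
    then show ?case using N.one_closed x by (simp add: zsmult)
  next
    case (step1 i)
    then show ?case using N.m_closed[OF step1(2) assms(2)] x by (simp add: zsmult)
  next
    case (step2 i)
    then show ?case
      using N.m_closed[OF step2(2) mx] zsmult(2)[OF x, of i "- 1"] m1 by simp
  qed
qed

lemma subgroup_tor: "subgroup (tor k) (add_monoid M)"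
proof (rule M.add.subgroupI)
  show "tor k \<noteq> {}" using zsmult_zero by (auto simp: tor_def)
qed (use smult_r_minus[of k] smult_r_distr[of k] in \<open>auto simp: tor_def\<close>)

text \<open>An integer prime to \<open>p\<close> is invertible modulo \<open>p\<close>, hence acts
  invertibly on the elements killed by \<open>p\<close>.\<close>

lemma tor_unit:
  assumes x: "x \<in> tor (int p)" and k: "\<not> int p dvd k"
  shows "\<exists>u. x = u \<odot>\<^bsub>M\<^esub> (k \<odot>\<^bsub>M\<^esub> x)"
proof -
  have xM: "x \<in> carrier M" and px: "int p \<odot>\<^bsub>M\<^esub> x = \<zero>\<^bsub>M\<^esub>" using x by (auto simp: tor_def)
  obtain u v where "u * k + v * int p = 1"
    using coprime_prime_power[OF prime k, of 1] by auto
  then have "x = (u * k) \<odot>\<^bsub>M\<^esub> x \<oplus>\<^bsub>M\<^esub> (v * int p) \<odot>\<^bsub>M\<^esub> x"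
    using xM by (metis zsmult(2,5))
  also have "(v * int p) \<odot>\<^bsub>M\<^esub> x = \<zero>\<^bsub>M\<^esub>"
    using zsmult(3)[OF xM, of v "int p"] px by (simp add: zsmult_zero)
  finally have "x = u \<odot>\<^bsub>M\<^esub> (k \<odot>\<^bsub>M\<^esub> x)" using xM by (simp add: zsmult)
  then show ?thesis ..
qed

text \<open>If comparability gives \<open>y = k x\<close> instead, then \<open>y \<noteq> 0\<close>
  forces \<open>k\<close> to be prime to \<open>p\<close>, and \<open>k\<close> can be inverted.
  Consequently \<open>tor (int p)\<close> lies in every nonzero subgroup.\<close>

lemma tor_multiple:
  assumes x: "x \<in> tor (int p)" and y: "y \<in> carrier M" "y \<noteq> \<zero>\<^bsub>M\<^esub>"
  shows "\<exists>k. x = k \<odot>\<^bsub>M\<^esub> y"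
proof -
  have xM: "x \<in> carrier M" and px: "int p \<odot>\<^bsub>M\<^esub> x = \<zero>\<^bsub>M\<^esub>" using x by (auto simp: tor_def)
  from comparable[OF xM y(1)] obtain k where k: "x = k \<odot>\<^bsub>M\<^esub> y \<or> y = k \<odot>\<^bsub>M\<^esub> x" ..
  show ?thesis
  proof (cases "x = k \<odot>\<^bsub>M\<^esub> y")
    case False
    with k have yk: "y = k \<odot>\<^bsub>M\<^esub> x" by simp
    have "\<not> int p dvd k"
    proof
      assume "int p dvd k"
      then obtain l where "k = l * int p" by (metis dvd_def mult.commute)
      then have "y = l \<odot>\<^bsub>M\<^esub> (int p \<odot>\<^bsub>M\<^esub> x)" using yk xM by (simp add: zsmult)
      with px y(2) show False by (simp add: zsmult_zero)
    qed
    with tor_unit[OF x] yk show ?thesis by blast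
  qed blast
qed

lemma ex_tor_nonzero: "\<exists>x\<in>tor (int p). x \<noteq> \<zero>\<^bsub>M\<^esub>"
proof -
  obtain x where x: "x \<in> carrier M" "x \<noteq> \<zero>\<^bsub>M\<^esub>" using nontrivial M.zero_closed by blast
  let ?P = "\<lambda>n. int p ^ n \<odot>\<^bsub>M\<^esub> x = \<zero>\<^bsub>M\<^esub>"
  from p_torsion[OF x(1)] obtain n where "?P n" "\<And>m. m < n \<Longrightarrow> \<not> ?P m"
    using exists_least_iff[of ?P] by blast
  \<comment> \<open>The least \<open>n\<close> is positive because \<open>1 x = x\<close> is
    nonzero; so \<open>p ^ m x\<close> is the last nonzero multiple, and \<open>p\<close> kills
    it.\<close>
  moreover from this x obtain m where "n = Suc m" by (cases n) (auto simp: zsmult)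
  ultimately show ?thesis using x
    by (intro bexI[of _ "int p ^ m \<odot>\<^bsub>M\<^esub> x"]) (auto simp: tor_def zsmult)
qed

text \<open>If \<open>p\<close> killed everything, divisibility by \<open>p\<close> would make every
  element zero.\<close>

lemma tor_psubset: "tor (int p) \<subset> carrier M"
proof -
  have "tor (int p) \<noteq> carrier M"
  proof
    assume eq: "tor (int p) = carrier M"
    have "x = \<zero>\<^bsub>M\<^esub>" if x: "x \<in> carrier M" for x
    proof -
      obtain y where "y \<in> carrier M" "x = int p \<odot>\<^bsub>M\<^esub> y"
        using divisible[OF _ x, of "int p"] prime by auto
      with eq show ?thesis by (auto simp: tor_def)
    qed
    then show False using nontrivial M.zero_closed by blast
  qed
  then show ?thesis by (auto simp: tor_def)
qed

text \<open>A subgroup with \<open>p > 1\<close> elements is nonzero, so it contains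
  \<open>tor (int p)\<close> by \<open>tor_multiple\<close>; equal finite cardinalities then force
  equality.\<close>

lemma subgroup_card_prime:
  assumes card: "card (tor (int p)) = p"
  shows "subgroup N (add_monoid M) \<and> card N = p \<longleftrightarrow> N = tor (int p)"
proof
  assume N: "subgroup N (add_monoid M) \<and> card N = p"
  have p: "p > 1" using prime prime_gt_1_nat by blast
  have sub: "N \<subseteq> carrier M" using N subgroup.subset by fastforce
  have fin: "finite N" using N p by (intro card_ge_0_finite) simp
  have "\<not> N \<subseteq> {\<zero>\<^bsub>M\<^esub>}"
    using N p card_mono[of "{\<zero>\<^bsub>M\<^esub>}" N] by auto
  then obtain y where "y \<in> N" "y \<noteq> \<zero>\<^bsub>M\<^esub>" by blast
  then have "tor (int p) \<subseteq> N"
    using tor_multiple sub subgroup_zsmult_closed N by blast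
  then show "N = tor (int p)"
    using fin card N by (metis card_subset_eq)
qed (use subgroup_tor card in auto)


section \<open>Ideals of the trivial extension\<close>

abbreviation A where "A \<equiv> trivial_extension int_ring M"
abbreviation embed where "embed \<equiv> zero_plus int_ring"

lemma A_simps:
  "(r, m) \<in> carrier A \<longleftrightarrow> m \<in> carrier M"
  "(r, m) \<otimes>\<^bsub>A\<^esub> (s, n) = (r * s, r \<odot>\<^bsub>M\<^esub> n \<oplus>\<^bsub>M\<^esub> s \<odot>\<^bsub>M\<^esub> m)"
  "\<zero>\<^bsub>A\<^esub> = (0, \<zero>\<^bsub>M\<^esub>)"
  "(r, m) \<in> embed N \<longleftrightarrow> r = 0 \<and> m \<in> N"
  by (auto simp: trivial_extension_def zero_plus_def)

lemma ideal_embed: "subgroup N (add_monoid M) \<Longrightarrow> ideal (embed N) A"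
  using ideal_zero_plus[of N] subgroup_zsmult_closed by blast

lemma subgroup_carrier: "subgroup (carrier M) (add_monoid M)"
  using M.add.subgroup_self by simp

text \<open>\<open>(r, m) (0, y) = (0, r y)\<close>, and by divisibility \<open>r y\<close> runs
  through all of \<open>M\<close>.\<close>

lemma embed_carrier_subset:
  assumes I: "ideal I A" and rm: "(r, m) \<in> I" "r \<noteq> 0"
  shows "embed (carrier M) \<subseteq> I"
proof
  fix a assume "a \<in> embed (carrier M)"
  then obtain n where n: "a = (0, n)" "n \<in> carrier M" by (cases a) (simp add: A_simps)
  obtain y where y: "y \<in> carrier M" "n = r \<odot>\<^bsub>M\<^esub> y" using divisible[OF rm(2) n(2)] by blast
  have m: "m \<in> carrier M" using ideal.Icarr[OF I rm(1)] by (simp add: A_simps)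
  have "(r, m) \<otimes>\<^bsub>A\<^esub> (0, y) \<in> I"
    using ideal.I_r_closed[OF I rm(1), of "(0, y)"] y by (simp add: A_simps)
  then show "a \<in> I" using n y m by (simp add: A_simps zsmult)
qed

lemma ideal_zsmult:
  assumes I: "ideal I A" and y: "(0, y) \<in> I"
  shows "(0, k \<odot>\<^bsub>M\<^esub> y) \<in> I"
proof -
  have "y \<in> carrier M" using ideal.Icarr[OF I y] by (simp add: A_simps)
  then show ?thesis
    using ideal.I_l_closed[OF I y, of "(k, \<zero>\<^bsub>M\<^esub>)"] by (simp add: A_simps zsmult zsmult_zero)
qed

text \<open>First components vanish by \<open>embed_carrier_subset\<close>. A second component
  \<open>y\<close> cannot have \<open>x\<close> as a multiple, so \<open>y\<close> is a multiple of
  \<open>x\<close> and dies with it.\<close>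

lemma ideal_killed:
  assumes I: "ideal I A" and x: "x \<in> carrier M" "(0, x) \<notin> I" "q \<odot>\<^bsub>M\<^esub> x = \<zero>\<^bsub>M\<^esub>"
  shows "I \<subseteq> embed (tor q)"
proof
  fix a assume a: "a \<in> I"
  obtain s y where sy: "a = (s, y)" by (cases a)
  have y: "y \<in> carrier M" using ideal.Icarr[OF I a] sy by (simp add: A_simps)
  have s: "s = 0" using embed_carrier_subset[OF I, of s y] a sy x by (auto simp: zero_plus_def)
  obtain k where "x = k \<odot>\<^bsub>M\<^esub> y \<or> y = k \<odot>\<^bsub>M\<^esub> x" using comparable[OF x(1) y] ..
  then have k: "y = k \<odot>\<^bsub>M\<^esub> x" using ideal_zsmult[OF I] a sy s x(2) by auto
  then have "q \<odot>\<^bsub>M\<^esub> y = k \<odot>\<^bsub>M\<^esub> (q \<odot>\<^bsub>M\<^esub> x)" using x(1) by (simp add: zsmult mult.commute)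
  then show "a \<in> embed (tor q)" using sy s y x(3) by (simp add: A_simps tor_def zsmult_zero)
qed

text \<open>Shows that \<open>embed (tor (int p))\<close> is the least nonzero ideal: a nonzero
  element has either nonzero first component or a nonzero \<open>y\<close> of which all
  \<open>p\<close>-torsion is a multiple.\<close>

lemma embed_tor_subset:
  assumes I: "ideal I A" "\<not> I \<subseteq> {\<zero>\<^bsub>A\<^esub>}"
  shows "embed (tor (int p)) \<subseteq> I"
proof -
  obtain r y where ry: "(r, y) \<in> I" "(r, y) \<noteq> \<zero>\<^bsub>A\<^esub>" using I(2) by auto
  have y: "y \<in> carrier M" using ideal.Icarr[OF I(1) ry(1)] by (simp add: A_simps)
  show ?thesis
  proof (cases "r = 0")
    case True
    show ?thesis
    proof
      fix a assume "a \<in> embed (tor (int p))"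
      then obtain n where n: "a = (0, n)" "n \<in> tor (int p)" by (cases a) (simp add: A_simps)
      then obtain k where "n = k \<odot>\<^bsub>M\<^esub> y" using tor_multiple y ry True by (auto simp: A_simps)
      then show "a \<in> I" using n ideal_zsmult[OF I(1)] ry True by simp
    qed
  next
    case False
    then show ?thesis
      using embed_carrier_subset[OF I(1) ry(1)] by (auto simp: zero_plus_def tor_def)
  qed
qed

section \<open>Coprime ideals of the trivial extension\<close>

lemma coprime_ideal_embed_carrier: "coprime_ideal A (embed (carrier M))"
  unfolding coprime_ideal_def
proof (intro conjI allI impI)
  show "ideal (embed (carrier M)) A" using ideal_embed subgroup_carrier by blast
  show "embed (carrier M) \<noteq> {\<zero>\<^bsub>A\<^esub>}" using nontrivial by (auto simp: zero_plus_def A_simps)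
next
  fix I J
  assume IJ: "ideal I A \<and> ideal J A \<and> embed (carrier M) \<subseteq> ideal_coproduct A I J"
  show "embed (carrier M) \<subseteq> I \<or> embed (carrier M) \<subseteq> J"
  proof (unfold disj_imp, rule impI)
    assume "\<not> embed (carrier M) \<subseteq> I"
    then obtain x where x: "x \<in> carrier M" "(0, x) \<notin> I" by (auto simp: zero_plus_def)
    obtain n where n: "int p ^ n \<odot>\<^bsub>M\<^esub> x = \<zero>\<^bsub>M\<^esub>" using p_torsion[OF x(1)] ..
    have I: "I \<subseteq> embed (tor (int p ^ n))" using ideal_killed IJ x n by blast
    \<comment> \<open>Multiplication by \<open>(p ^ n, 0)\<close> is multiplication by
      \<open>p ^ n\<close> on second components once first components are zero.\<close>
    have ann: "(int p ^ n, \<zero>\<^bsub>M\<^esub>) \<in> annihilator A I"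
      using I by (auto simp: annihilator_def A_simps tor_def zsmult)
    show "embed (carrier M) \<subseteq> J"
    proof
      fix a assume "a \<in> embed (carrier M)"
      then obtain z where z: "a = (0, z)" "z \<in> carrier M" by (cases a) (simp add: A_simps)
      obtain w where w: "w \<in> carrier M" "z = int p ^ n \<odot>\<^bsub>M\<^esub> w"
        using divisible[OF _ z(2), of "int p ^ n"] prime by auto
      have "(0, w) \<in> ideal_coproduct A I J" using IJ w by (auto simp: A_simps)
      \<comment> \<open>This product is \<open>(0, p ^ n w) = (0, z) = a\<close>.\<close>
      then have "(0, w) \<otimes>\<^bsub>A\<^esub> (int p ^ n, \<zero>\<^bsub>M\<^esub>) \<in> J"
        using ann by (auto simp: ideal_coproduct_def ideal_quotient_def)
      then show "a \<in> J" using z w by (simp add: A_simps zsmult_zero zsmult)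
    qed
  qed
qed

text \<open>By minimality, an \<open>I\<close> not containing this ideal is zero. Then the identity
  annihilates \<open>I\<close>, so \<open>[I:J]\<close> is contained in \<open>J\<close>.\<close>

lemma coprime_ideal_embed_tor: "coprime_ideal A (embed (tor (int p)))"
  unfolding coprime_ideal_def
proof (intro conjI allI impI)
  show "ideal (embed (tor (int p))) A" using ideal_embed subgroup_tor by blast
  show "embed (tor (int p)) \<noteq> {\<zero>\<^bsub>A\<^esub>}"
    using ex_tor_nonzero by (auto simp: zero_plus_def A_simps)
next
  interpret A: cring A by (rule cring_trivial_extension)
  fix I J
  assume IJ: "ideal I A \<and> ideal J A \<and> embed (tor (int p)) \<subseteq> ideal_coproduct A I J"
  show "embed (tor (int p)) \<subseteq> I \<or> embed (tor (int p)) \<subseteq> J"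
  proof (unfold disj_imp, rule impI)
    assume "\<not> embed (tor (int p)) \<subseteq> I"
    then have "I \<subseteq> {\<zero>\<^bsub>A\<^esub>}" using embed_tor_subset IJ by blast
    then have "\<one>\<^bsub>A\<^esub> \<in> annihilator A I" by (auto simp: annihilator_def)
    then have "a \<otimes>\<^bsub>A\<^esub> \<one>\<^bsub>A\<^esub> \<in> J" "a \<in> carrier A" if "a \<in> embed (tor (int p))" for a
      using IJ that by (auto simp: ideal_coproduct_def ideal_quotient_def)
    then show "embed (tor (int p)) \<subseteq> J" by auto
  qed
qed

text \<open>By \<open>tor_unit\<close>, an \<open>s\<close> prime to \<open>p\<close> cannot kill a
  nonzero element of \<open>tor (int p)\<close>.\<close>

lemma annihilator_torD:
  assumes st: "(s, t) \<in> annihilator A (embed (tor (int p)))"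
  shows "t \<in> carrier M" "int p dvd s"
proof -
  show t: "t \<in> carrier M" using st by (simp add: annihilator_def A_simps)
  obtain x where x: "x \<in> tor (int p)" "x \<noteq> \<zero>\<^bsub>M\<^esub>" using ex_tor_nonzero by blast
  then have "(0, x) \<in> embed (tor (int p))" by (simp add: A_simps)
  then have "(s, t) \<otimes>\<^bsub>A\<^esub> (0, x) = \<zero>\<^bsub>A\<^esub>" using st by (simp add: annihilator_def)
  then have "s \<odot>\<^bsub>M\<^esub> x = \<zero>\<^bsub>M\<^esub>" using x t by (simp add: A_simps zsmult tor_def)
  then show "int p dvd s" using tor_unit[OF x(1), of s] x(2) by (auto simp: zsmult_zero)
qed

lemma coprime_ideal_subset_embed:
  assumes C: "coprime_ideal A C"
  shows "C \<subseteq> embed (carrier M)"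
proof -
  let ?M = "embed (carrier M)"
  have I: "ideal C A" using C by (simp add: coprime_ideal_def)
  obtain x where x: "x \<in> tor (int p)" "x \<noteq> \<zero>\<^bsub>M\<^esub>" using ex_tor_nonzero by blast
  \<comment> \<open>A nonzero \<open>s\<close> would kill some \<open>y\<close> with
    \<open>s y = x\<close>, although \<open>x\<close> is nonzero. So the annihilator of
    \<open>?M\<close> lies in \<open>?M\<close>.\<close>
  have "s = 0" if sn: "(s, n) \<in> annihilator A ?M" for s n
  proof (rule ccontr)
    assume s: "s \<noteq> 0"
    obtain y where y: "y \<in> carrier M" "x = s \<odot>\<^bsub>M\<^esub> y"
      using divisible[OF s] x by (auto simp: tor_def)
    then have "(0, y) \<in> ?M" by (simp add: A_simps)
    then have "(s, n) \<otimes>\<^bsub>A\<^esub> (0, y) = \<zero>\<^bsub>A\<^esub>" "(s, n) \<in> carrier A"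
      using sn unfolding annihilator_def by blast+
    with x y show False by (simp add: A_simps zsmult)
  qed
  moreover have "m \<in> carrier M" if "(s, m) \<in> annihilator A ?M \<or> (s, m) \<in> C" for s m
    using that ideal.Icarr[OF I] by (auto simp: annihilator_def A_simps)
  \<comment> \<open>Multiplying any element of \<open>C\<close> by an annihilator element
    \<open>(0, n)\<close> gives first component \<open>0\<close>.\<close>
  ultimately have "C \<subseteq> ideal_coproduct A ?M ?M"
    by (fastforce simp: ideal_coproduct_def ideal_quotient_def A_simps zsmult)
  then show ?thesis
    using C ideal_embed[OF subgroup_carrier] by (auto simp: coprime_ideal_def)
qed

lemma coprime_ideal_cases:
  assumes C: "coprime_ideal A C"
  shows "C = embed (tor (int p)) \<or> C = embed (carrier M)"
proof (rule disjCI)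
  let ?S = "embed (tor (int p))"
  assume "C \<noteq> embed (carrier M)"
  have I: "ideal C A" and nz: "C \<noteq> {\<zero>\<^bsub>A\<^esub>}" using C by (auto simp: coprime_ideal_def)
  have CM: "C \<subseteq> embed (carrier M)" by (rule coprime_ideal_subset_embed[OF C])
  have "\<zero>\<^bsub>A\<^esub> \<in> C" using additive_subgroup.zero_closed[of C A] I by (simp add: ideal_def)
  with nz have nsub: "\<not> C \<subseteq> {\<zero>\<^bsub>A\<^esub>}" by blast
  from CM \<open>C \<noteq> embed (carrier M)\<close> obtain x where x: "x \<in> carrier M" "(0, x) \<notin> C"
    by (auto simp: zero_plus_def)
  obtain k where "int p ^ k \<odot>\<^bsub>M\<^esub> x = \<zero>\<^bsub>M\<^esub>" using p_torsion[OF x(1)] ..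
  then have ex: "C \<subseteq> embed (tor (int p ^ k))" using ideal_killed[OF I x] by blast
  define P where "P n \<longleftrightarrow> C \<subseteq> embed (tor (int p ^ n))" for n
  obtain n where n: "P n" "\<And>m. m < n \<Longrightarrow> \<not> P m"
    using ex exists_least_iff[of P] P_def by blast
  \<comment> \<open>\<open>tor (p ^ 0) = tor 1\<close> is zero, whereas \<open>C\<close> is not;
    hence \<open>n\<close> has a predecessor \<open>m\<close>.\<close>
  have "\<not> P 0" using nsub by (auto simp: P_def tor_def A_simps zero_plus_def zsmult)
  then obtain m where m: "n = Suc m" using n by (cases n) auto
  let ?J = "embed (tor (int p ^ m))"
  have "C \<subseteq> ideal_coproduct A ?S ?J"
  proof
    fix c assume c: "c \<in> C"
    then obtain y where y: "c = (0, y)" "y \<in> tor (int p ^ n)"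
      using n(1) by (auto simp: P_def zero_plus_def)
    then have yM: "y \<in> carrier M" by (simp add: tor_def)
    have "c \<otimes>\<^bsub>A\<^esub> b \<in> ?J" if b: "b \<in> annihilator A ?S" for b
    proof -
      obtain s t where st: "b = (s, t)" by (cases b)
      from b st have t: "t \<in> carrier M" and "int p dvd s" using annihilator_torD by blast+
      then obtain l where l: "s = int p * l" by blast
      \<comment> \<open>The factor \<open>p\<close> of \<open>s\<close> raises \<open>p ^ m\<close>
        to \<open>p ^ n\<close>, which kills \<open>y\<close>.\<close>
      have "int p ^ m \<odot>\<^bsub>M\<^esub> (s \<odot>\<^bsub>M\<^esub> y) = l \<odot>\<^bsub>M\<^esub> (int p ^ n \<odot>\<^bsub>M\<^esub> y)"
        using yM by (simp add: zsmult l m algebra_simps)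
      then have "int p ^ m \<odot>\<^bsub>M\<^esub> (s \<odot>\<^bsub>M\<^esub> y) = \<zero>\<^bsub>M\<^esub>"
        using y(2) by (simp add: tor_def zsmult_zero)
      then show ?thesis
        using y yM t st by (simp add: A_simps zsmult(1,4) tor_def)
    qed
    then show "c \<in> ideal_coproduct A ?S ?J"
      using ideal.Icarr[OF I c] by (auto simp: ideal_coproduct_def ideal_quotient_def)
  qed
  \<comment> \<open>Minimality of \<open>n\<close> rules out \<open>?J\<close>, so coprimality
    leaves only \<open>?S\<close>.\<close>
  moreover have "\<not> C \<subseteq> ?J" using n(2)[of m] m by (simp add: P_def)
  ultimately have "C \<subseteq> ?S"
    using C ideal_embed[OF subgroup_tor] unfolding coprime_ideal_def by blast
  then show "C = ?S" using embed_tor_subset[OF I nsub] by blast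
qed

theorem CoSp_trivial_extension: "CoSp A = {embed (tor (int p)), embed (carrier M)}"
  unfolding CoSp_def
  using coprime_ideal_cases coprime_ideal_embed_tor coprime_ideal_embed_carrier by blast

end


subsection \<open>Elements of the Pruefer group\<close>

abbreviation rat_coset :: "rat \<Rightarrow> rat set" where
  "rat_coset q \<equiv> \<int> #>\<^bsub>rat_group\<^esub> q"

lemma rat_coset_eq: "rat_coset q = {r. r - q \<in> \<int>}"
proof -
  have "r \<in> rat_coset q \<longleftrightarrow> r - q \<in> \<int>" for r
    unfolding r_coset_def rat_group_def
    by (auto simp: algebra_simps intro!: bexI[of _ "r - q"])
  then show ?thesis by blast
qed

lemma rat_coset_eq_iff: "rat_coset q = rat_coset r \<longleftrightarrow> q - r \<in> \<int>"
proof
  assume "rat_coset q = rat_coset r"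
  moreover have "q \<in> rat_coset q" by (simp add: rat_coset_eq)
  ultimately show "q - r \<in> \<int>" by (simp add: rat_coset_eq)
next
  assume *: "q - r \<in> \<int>"
  have "s - q \<in> \<int> \<longleftrightarrow> s - r \<in> \<int>" for s
    using Ints_add[OF _ *, of "s - q"] Ints_diff[OF _ *, of "s - r"] by auto
  then show "rat_coset q = rat_coset r" by (simp add: rat_coset_eq)
qed

lemma carrier_rat_mod_int: "carrier rat_mod_int = range rat_coset"
  by (auto simp: rat_mod_int_def FactGroup_def RCOSETS_def rat_group_def)

lemma one_rat_mod_int: "\<one>\<^bsub>rat_mod_int\<^esub> = rat_coset 0"
  by (simp add: rat_mod_int_def FactGroup_def rat_coset_eq)

lemma pow_rat_group: "q [^]\<^bsub>rat_group\<^esub> (k::int) = of_int k * q"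
proof -
  interpret G: comm_group rat_group by (rule comm_group_rat_group)
  have [simp]: "x \<otimes>\<^bsub>rat_group\<^esub> y = x + y" "\<one>\<^bsub>rat_group\<^esub> = 0" "x \<in> carrier rat_group" for x y
    by (simp_all add: rat_group_def)
  have nat: "q [^]\<^bsub>rat_group\<^esub> (n::nat) = of_nat n * q" for n
    by (induction n) (simp_all add: algebra_simps)
  have "inv\<^bsub>rat_group\<^esub> x = - x" for x
    by (rule G.inv_equality) simp_all
  then show ?thesis by (simp add: int_pow_def2 nat)
qed

lemma pow_rat_coset: "rat_coset q [^]\<^bsub>rat_mod_int\<^esub> (k::int) = rat_coset (of_int k * q)"
proof -
  interpret G: comm_group rat_group by (rule comm_group_rat_group)
  interpret N: normal "\<int>" rat_group
    by (rule G.subgroup_imp_normal[OF subgroup_Ints_rat_group])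
  show ?thesis
    unfolding rat_mod_int_def
    using N.FactGroup_int_pow[of q k] by (simp add: rat_group_def pow_rat_group[unfolded rat_group_def])
qed

section \<open>Fractions with \<open>p\<close>-power denominators\<close>

lemma zero_pruefer_module: "\<zero>\<^bsub>pruefer_module p\<^esub> = rat_coset 0"
  by (simp add: pruefer_module_def one_rat_mod_int)

lemma smult_pruefer_module: "k \<odot>\<^bsub>pruefer_module p\<^esub> rat_coset q = rat_coset (of_int k * q)"
  by (simp add: pruefer_module_def pow_rat_coset)

text \<open>The coset of \<open>q\<close> is killed by \<open>p ^ n\<close> exactly when
  \<open>p ^ n q\<close> is an integer. This replaces element orders by explicit fractions.\<close>

lemma carrier_pruefer_module_eq:
  assumes p: "prime p"
  shows "carrier (pruefer_module p) = (\<Union>n. range (\<lambda>a. rat_coset (of_int a / of_nat p ^ n)))"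
proof -
  have p0: "(of_nat p :: rat) \<noteq> 0" using p by auto
  have "rat_coset q \<in> carrier (pruefer_module p) \<longleftrightarrow> (\<exists>n. of_nat p ^ n * q \<in> \<int>)" for q
  proof -
    have "rat_coset q [^]\<^bsub>rat_mod_int\<^esub> (p ^ n) = rat_coset (of_nat p ^ n * q)" for n
      using pow_rat_coset[of q "int (p ^ n)"] by (simp add: int_pow_int del: of_nat_power) simp
    then show ?thesis
      using p by (auto simp: carrier_pruefer_module carrier_rat_mod_int one_rat_mod_int rat_coset_eq_iff)
  qed
  moreover have "of_nat p ^ n * q \<in> \<int> \<longleftrightarrow> (\<exists>a. q = of_int a / of_nat p ^ n)" for n and q :: rat
    using p0 by (auto simp: Ints_def field_simps)
  ultimately have mem: "rat_coset q \<in> carrier (pruefer_module p) \<longleftrightarrow>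
      (\<exists>n a. q = of_int a / of_nat p ^ n)" for q
    by simp
  show ?thesis
  proof (intro equalityI subsetI)
    fix x assume x: "x \<in> carrier (pruefer_module p)"
    then obtain q where "x = rat_coset q"
      using p by (auto simp: carrier_pruefer_module carrier_rat_mod_int)
    with x show "x \<in> (\<Union>n. range (\<lambda>a. rat_coset (of_int a / of_nat p ^ n)))"
      using mem[of q] by auto
  next
    fix x assume "x \<in> (\<Union>n. range (\<lambda>a. rat_coset (of_int a / of_nat p ^ n)))"
    then obtain n a where "x = rat_coset (of_int a / of_nat p ^ n)" by auto
    then show "x \<in> carrier (pruefer_module p)"
      using mem[of "of_int a / of_nat p ^ n"] by auto
  qed
qed

lemma rat_coset_in_pruefer_module:
  "prime p \<Longrightarrow> rat_coset (of_int a / of_nat p ^ n) \<in> carrier (pruefer_module p)"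
  unfolding carrier_pruefer_module_eq by blast

text \<open>With \<open>u b = 1 - v p ^ n\<close>, the two representatives differ by the integer
  \<open>- v a\<close>.\<close>

lemma rat_coset_unit_multiple:
  assumes p: "prime (p::nat)" and b: "\<not> int p dvd b"
  shows "\<exists>u. rat_coset (of_int (u * b) * (of_int a / of_nat p ^ n)) = rat_coset (of_int a / of_nat p ^ n)"
proof -
  obtain u v where uv: "u * b + v * int p ^ n = 1" using coprime_prime_power[OF p b] by blast
  then have ub: "(of_int (u * b) :: rat) = 1 - of_int v * of_nat p ^ n"
    by (metis add_diff_cancel_right' of_int_1 of_int_diff of_int_mult of_int_of_nat_eq of_int_power)
  have p0: "(of_nat p :: rat) \<noteq> 0" using p by auto
  have "of_int (u * b) * (of_int a / of_nat p ^ n) - of_int a / of_nat p ^ n = (of_int (- v * a) :: rat)"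
    unfolding ub using p0 by (simp add: field_simps)
  then show ?thesis by (metis rat_coset_eq_iff Ints_of_int)
qed

text \<open>Split \<open>k = p ^ j b\<close> with \<open>b\<close> prime to \<open>p\<close>:
  dividing by \<open>p ^ j\<close> enlarges the denominator, and dividing by \<open>b\<close> is
  multiplying by its inverse \<open>u\<close>.\<close>

lemma divisible_pruefer_module:
  assumes p: "prime p" and k: "k \<noteq> 0" and x: "x \<in> carrier (pruefer_module p)"
  shows "\<exists>y\<in>carrier (pruefer_module p). x = k \<odot>\<^bsub>pruefer_module p\<^esub> y"
proof -
  have p0: "(of_nat p :: rat) \<noteq> 0" using p by auto
  obtain a n where a: "x = rat_coset (of_int a / of_nat p ^ n)"
    using x p by (auto simp: carrier_pruefer_module_eq)
  obtain b where b: "k = int p ^ multiplicity (int p) k * b" "\<not> int p dvd b"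
    using multiplicity_decompose'[of k "int p"] k p by (metis not_prime_unit prime_nat_int_transfer)
  define j where "j = multiplicity (int p) k"
  have kj: "k = int p ^ j * b" using b j_def by simp
  obtain u where u: "rat_coset (of_int (u * b) * (of_int a / of_nat p ^ n)) = x"
    using rat_coset_unit_multiple[OF p b(2)] a by blast
  have "of_int k * (of_int (u * a) / of_nat p ^ (n + j)) = (of_int (u * b) * (of_int a / of_nat p ^ n) :: rat)"
    unfolding kj using p0 by (simp add: field_simps power_add)
  then have "x = k \<odot>\<^bsub>pruefer_module p\<^esub> rat_coset (of_int (u * a) / of_nat p ^ (n + j))"
    using u by (simp only: smult_pruefer_module)
  then show ?thesis
    using rat_coset_in_pruefer_module[OF p] by blast
qed

text \<open>In lowest terms, the fraction with the larger denominator generates the other one modulo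
  the integers.\<close>

lemma comparable_pruefer_module:
  assumes p: "prime p" and x: "x \<in> carrier (pruefer_module p)" and y: "y \<in> carrier (pruefer_module p)"
  shows "\<exists>k. x = k \<odot>\<^bsub>pruefer_module p\<^esub> y \<or> y = k \<odot>\<^bsub>pruefer_module p\<^esub> x"
proof -
  have p0: "(of_nat p :: rat) \<noteq> 0" using p by auto
  \<comment> \<open>Common factors \<open>p\<close> are cancelled by induction on \<open>n\<close>;
    at exponent \<open>0\<close> the fraction is an integer and its coset is zero.\<close>
  have reduced: "z = rat_coset 0 \<or> (\<exists>a n. z = rat_coset (of_int a / of_nat p ^ n) \<and> \<not> int p dvd a)"
    if z: "z \<in> carrier (pruefer_module p)" for z
  proof -
    obtain a n where "z = rat_coset (of_int a / of_nat p ^ n)"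
      using z p by (auto simp: carrier_pruefer_module_eq)
    then show ?thesis
    proof (induction n arbitrary: a)
      case 0
      then show ?case by (auto simp: rat_coset_eq_iff)
    next
      case (Suc n)
      show ?case
      proof (cases "int p dvd a")
        case True
        then obtain c where "a = int p * c" ..
        then show ?thesis using Suc p0 by auto
      qed (use Suc in blast)
    qed
  qed
  have multiple: "\<exists>k. rat_coset (of_int a / of_nat p ^ m) =
      k \<odot>\<^bsub>pruefer_module p\<^esub> rat_coset (of_int b / of_nat p ^ n)"
    if "m \<le> n" "\<not> int p dvd b" for a b :: int and m n
  proof -
    obtain u where "rat_coset (of_int (u * b) * (of_int a / of_nat p ^ m)) =
        rat_coset (of_int a / of_nat p ^ m)"
      using rat_coset_unit_multiple[OF p \<open>\<not> int p dvd b\<close>] by blast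
    \<comment> \<open>Here \<open>u\<close> inverts \<open>b\<close> modulo \<open>p ^ m\<close>,
      and \<open>p ^ (n - m)\<close> reduces the denominator \<open>p ^ n\<close> to
      \<open>p ^ m\<close>.\<close>
    moreover have "(of_int (u * b) * (of_int a / of_nat p ^ m) :: rat) =
        of_int (u * a * int p ^ (n - m)) * (of_int b / of_nat p ^ n)"
      using p0 \<open>m \<le> n\<close> by (simp add: field_simps flip: power_add)
    ultimately have "rat_coset (of_int a / of_nat p ^ m) =
        (u * a * int p ^ (n - m)) \<odot>\<^bsub>pruefer_module p\<^esub> rat_coset (of_int b / of_nat p ^ n)"
      by (simp only: smult_pruefer_module)
    then show ?thesis ..
  qed
  have zero: "rat_coset 0 = 0 \<odot>\<^bsub>pruefer_module p\<^esub> z" if "z \<in> carrier (pruefer_module p)" for z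
    using that p by (auto simp: carrier_pruefer_module_eq smult_pruefer_module)
  from reduced[OF x] show ?thesis
  proof (elim disjE exE conjE)
    fix a m assume a: "x = rat_coset (of_int a / of_nat p ^ m)" "\<not> int p dvd a"
    from reduced[OF y] show ?thesis
    proof (elim disjE exE conjE)
      fix b n assume "y = rat_coset (of_int b / of_nat p ^ n)" "\<not> int p dvd b"
      with a show ?thesis using multiple[of m n b a] multiple[of n m a b] by (metis nat_le_linear)
    qed (use zero[OF x] in blast)
  qed (use zero[OF y] in blast)
qed

section \<open>The Pruefer group as an instance, and its \<open>p\<close>-torsion\<close>

lemma divisible_uniserial_pruefer_module:
  assumes p: "prime p"
  shows "divisible_uniserial_p_group (pruefer_module p) p"
proof -
  have p0: "(of_nat p :: rat) \<noteq> 0" using p by auto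
  show ?thesis
  proof (intro divisible_uniserial_p_group.intro divisible_uniserial_p_group_axioms.intro)
    show "module int_ring (pruefer_module p)" by (rule module_pruefer_module[OF p])
    show "carrier (pruefer_module p) \<noteq> {\<zero>\<^bsub>pruefer_module p\<^esub>}"
    proof
      assume *: "carrier (pruefer_module p) = {\<zero>\<^bsub>pruefer_module p\<^esub>}"
      \<comment> \<open>The coset of \<open>1 / p\<close> is nonzero: otherwise \<open>p\<close>
        would divide \<open>1\<close>.\<close>
      have "rat_coset (of_int 1 / of_nat p ^ 1) \<in> carrier (pruefer_module p)"
        by (rule rat_coset_in_pruefer_module[OF p])
      then have "(1 / of_nat p :: rat) \<in> \<int>"
        by (simp add: * zero_pruefer_module rat_coset_eq_iff)
      then obtain c where "(1 / of_nat p :: rat) = of_int c" by (auto elim: Ints_cases)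
      then have "(of_int (c * int p) :: rat) = of_int 1" using p0 by (simp add: field_simps)
      then have "c * int p = 1" by (simp only: of_int_eq_iff)
      then show False using p by (metis dvd_triv_right not_prime_unit prime_nat_int_transfer)
    qed
    fix x assume "x \<in> carrier (pruefer_module p)"
    then obtain a n where "x = rat_coset (of_int a / of_nat p ^ n)"
      using p by (auto simp: carrier_pruefer_module_eq)
    then have "int p ^ n \<odot>\<^bsub>pruefer_module p\<^esub> x = \<zero>\<^bsub>pruefer_module p\<^esub>"
      using p0 by (simp add: smult_pruefer_module zero_pruefer_module rat_coset_eq_iff)
    then show "\<exists>n. int p ^ n \<odot>\<^bsub>pruefer_module p\<^esub> x = \<zero>\<^bsub>pruefer_module p\<^esub>" ..
  qed (use p divisible_pruefer_module comparable_pruefer_module in auto)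
qed

text \<open>The \<open>p\<close>-torsion consists of the cosets of \<open>i / p\<close> for
  \<open>i < p\<close>; two of them agree only if \<open>i\<close> and \<open>j\<close> are
  congruent modulo \<open>p\<close>.\<close>

lemma card_tor_pruefer_module:
  assumes p: "prime p"
  shows "card (divisible_uniserial_p_group.tor (pruefer_module p) (int p)) = p"
proof -
  interpret divisible_uniserial_p_group "pruefer_module p" p
    by (rule divisible_uniserial_pruefer_module[OF p])
  have p0: "(of_nat p :: rat) > 0" using p prime_gt_0_nat by simp
  let ?f = "\<lambda>i::nat. rat_coset (of_nat i / of_nat p)"
  have inj: "inj_on ?f {..<p}"
  proof (rule inj_onI)
    fix i j assume ij: "i \<in> {..<p}" "j \<in> {..<p}" "?f i = ?f j"
    then obtain c where "(of_nat i / of_nat p - of_nat j / of_nat p :: rat) = of_int c"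
      by (auto simp: rat_coset_eq_iff elim: Ints_cases)
    then have "(of_int (int i - int j) :: rat) = of_int (c * int p)"
      using p0 by (simp add: field_simps)
    then have "int i - int j = c * int p" by (simp only: of_int_eq_iff)
    then have "int i mod int p = int j mod int p"
      by (metis dvd_triv_right mod_eq_dvd_iff)
    then show "i = j" using ij by (simp flip: of_nat_mod)
  qed
  have "tor (int p) = ?f ` {..<p}"
  proof (intro equalityI subsetI)
    fix x assume "x \<in> tor (int p)"
    then have x: "x \<in> carrier (pruefer_module p)"
        "int p \<odot>\<^bsub>pruefer_module p\<^esub> x = \<zero>\<^bsub>pruefer_module p\<^esub>"
      by (simp_all add: tor_def)
    then obtain q where q: "x = rat_coset q"
      using p by (auto simp: carrier_pruefer_module_eq)
    with x(2) have "of_nat p * q \<in> \<int>"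
      by (simp add: smult_pruefer_module zero_pruefer_module rat_coset_eq_iff)
    then obtain c where c: "of_nat p * q = of_int c" by (auto elim: Ints_cases)
    \<comment> \<open>Replacing the numerator \<open>c\<close> by its remainder modulo
      \<open>p\<close> changes \<open>q = c / p\<close> by an integer only.\<close>
    define i where "i = nat (c mod int p)"
    have i: "int i = c mod int p" "i < p" using p prime_gt_0_nat
      by (auto simp: i_def nat_less_iff)
    have "c = int i + int p * (c div int p)" using i by simp
    then have "of_nat p * q = of_nat i + of_nat p * of_int (c div int p)"
      unfolding c by (metis of_int_add of_int_mult of_int_of_nat_eq)
    then have "q - of_nat i / of_nat p = of_int (c div int p)" using p0 by (simp add: field_simps)
    then have "x = ?f i" unfolding q rat_coset_eq_iff by simp
    then show "x \<in> ?f ` {..<p}" using i by blast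
  next
    fix x assume "x \<in> ?f ` {..<p}"
    then obtain i where i: "x = rat_coset (of_int (int i) / of_nat p ^ 1)" by auto
    then have "x \<in> carrier (pruefer_module p)"
      by (simp only: rat_coset_in_pruefer_module[OF p])
    then show "x \<in> tor (int p)"
      using i p0 by (simp add: tor_def smult_pruefer_module zero_pruefer_module rat_coset_eq_iff)
  qed
  then show ?thesis using inj by (simp add: card_image)
qed

text \<open>The unique-existence conjunct gives meaning to the description defining
  \<open>pruefer_order_p_subgroup\<close>; the last two conjuncts express the generic and the closed
  point.\<close>

theorem corollary4:
  fixes p :: nat
  assumes "prime p"
  shows
    "let M = pruefer_module p;
         A = trivial_extension int_ring M;
         T = CoSp_topology A;
         Cp = zero_plus int_ring (pruefer_order_p_subgroup p);
         M' = zero_plus int_ring (carrier M)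
     in (\<exists>!N. subgroup N (add_monoid M) \<and> card N = p)
      \<and> CoSp A = {Cp, M'}
      \<and> T homeomorphic_space sierpinski_space
      \<and> {F. closedin T F} = {{}, V\<^sub>c A Cp, V\<^sub>c A M'}
      \<and> V\<^sub>c A Cp = {Cp}
      \<and> V\<^sub>c A M' = CoSp A
      \<and> {U. openin T U} = {{}, {M'}, CoSp A}
      \<and> (\<forall>P\<in>CoSp A. T closure_of {P} = topspace T \<longleftrightarrow> P = M')
      \<and> (\<forall>P\<in>CoSp A. closedin T {P} \<longleftrightarrow> P = Cp)"
proof -
  define M where "M = pruefer_module p"
  interpret divisible_uniserial_p_group M p
    unfolding M_def by (rule divisible_uniserial_pruefer_module[OF assms])
  interpret A: cring A by (rule cring_trivial_extension)
  let ?C = "embed (tor (int p))" and ?D = "embed (carrier M)"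
  have card: "card (tor (int p)) = p"
    unfolding M_def by (rule card_tor_pruefer_module[OF assms])
  \<comment> \<open>\<open>subgroup_card_prime\<close> turns the defining condition into equality
    with \<open>tor (int p)\<close>, which settles both claims.\<close>
  have uniq: "\<exists>!N. subgroup N (add_monoid M) \<and> card N = p"
    and Cp: "pruefer_order_p_subgroup p = tor (int p)"
    unfolding pruefer_order_p_subgroup_def
    by (auto simp: subgroup_card_prime[OF card] simp flip: M_def)
  have CoSp: "CoSp A = {?C, ?D}" by (rule CoSp_trivial_extension)
  have less: "?C \<subset> ?D" using tor_psubset by (auto simp: zero_plus_def)
  note chain = A.Vc_chain[OF CoSp less] A.closedin_chain[OF CoSp less]
    A.openin_chain[OF CoSp less] A.closure_of_chain[OF CoSp less]
    A.homeomorphic_sierpinski_chain[OF CoSp less]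
  have closed: "closedin (CoSp_topology A) F \<longleftrightarrow> F \<in> {{}, {?C}, {?C, ?D}}" for F
    using chain(3) by blast
  have ne: "?C \<noteq> ?D" using less by blast
  show ?thesis
    unfolding Let_def M_def[symmetric] Cp
  proof (intro conjI ballI)
    fix P assume "P \<in> CoSp A"
    then have P: "P = ?C \<or> P = ?D" by (simp add: CoSp)
    show "CoSp_topology A closure_of {P} = topspace (CoSp_topology A) \<longleftrightarrow> P = ?D"
      using P
    proof
      assume "P = ?C"
      with chain(5) ne show ?thesis unfolding A.topspace_CoSp_topology CoSp by blast
    next
      assume "P = ?D"
      with chain(6) show ?thesis unfolding A.topspace_CoSp_topology CoSp by blast
    qed
    show "closedin (CoSp_topology A) {P} \<longleftrightarrow> P = ?C"
      using P ne unfolding closed by blast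
  qed (use uniq chain(1-4,7) in \<open>simp_all only: CoSp\<close>)
qed

end
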